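(* Let $n \geq 1$ be a positive integer. There exists a graph $G$ that is $\chi_{ig}^{A}$-lower-game-vertex-critical and $\chi_{ig}^{AB}$-lower-game-vertex-critical, such that $\chi_{ig}^{A}(G)-\chi_{ig}^{A}(G-x)=n$ and $\chi_{ig}^{AB}(G)-\chi_{ig}^{AB}(G-x)=n$ for every vertex $x \in V(G)$.
   Context: All graphs are simple, undirected and finite. The independence coloring game on a graph $G$ is played by Alice and Bob in rounds, round $i$ being played with color $i$ ($i=1,2,\ldots$). Within a round the players alternate moves, each move consisting of coloring a previously uncolored vertex with the color of the round so that the vertices colored in the same round form an independent set. A round is completed when no uncolored vertex can be given the color of the round (every uncolored vertex is adjacent to a vertex colored in this round). The game is over when all vertices are colored. Alice wants to finish in as few rounds as possible, Bob in as many rounds as possible. In the A-independence coloring game every round is started by Alice; the number of rounds when both players play optimally is the A-independence game chromatic number $\chi_{ig}^{A}(G)$. In the AB-independence coloring game Alice starts the first round and each further round is started by the player who did not make the last move of the previous round; the number of rounds when both players play optimally is the AB-independence game chromatic number $\chi_{ig}^{AB}(G)$. For $x\in V(G)$, $G-x$ is the graph obtained from $G$ by deleting $x$ and all edges incident with $x$. For $\varphi\in\{\chi_{ig}^{A},\chi_{ig}^{AB}\}$, a graph $G$ is $\varphi$-lower-game-vertex-critical if $\varphi(G-x)<\varphi(G)$ for every $x\in V(G)$. *)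

theory Defs
  imports "Graph_Theory.Digraph"
begin

datatype player = Alice | Bob

fun opponent :: "player \<Rightarrow> player" where
  "opponent Alice = Bob"
| "opponent Bob = Alice"

text \<open>
  Graphs are the finite symmetric loopfree digraphs without parallel arcs of the locale
  \<^locale>\<open>graph\<close>, so adjacency of \<open>v\<close> and \<open>w\<close> is \<open>v \<rightarrow>\<^bsub>G\<^esub> w\<close>.  A stage of the game is a partial
  coloring \<open>c\<close> of the vertices.
\<close>

definition uncolored :: "('a, 'b) pre_digraph \<Rightarrow> ('a \<Rightarrow> nat option) \<Rightarrow> 'a set" where
  "uncolored G c = {v \<in> verts G. c v = None}"

definition moves :: "('a, 'b) pre_digraph \<Rightarrow> ('a \<Rightarrow> nat option) \<Rightarrow> nat \<Rightarrow> 'a set" where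
  "moves G c i = {v \<in> uncolored G c. \<not> (\<exists>w \<in> verts G. c w = Some i \<and> v \<rightarrow>\<^bsub>G\<^esub> w)}"

text \<open>
  \<open>game_value G starter c i p\<close> is the index of the last round under optimal play, when the current
  coloring is \<open>c\<close>, the current round is \<open>i\<close> and \<open>p\<close> has the next move.  If round \<open>i\<close> is completed
  and the game is not over, then \<open>p\<close> is the player who did not make its last move, and
  \<open>starter p\<close> starts round \<open>i + 1\<close>.  The finiteness test only serves to make the function total.
\<close>

function game_value ::
  "('a, 'b) pre_digraph \<Rightarrow> (player \<Rightarrow> player) \<Rightarrow> ('a \<Rightarrow> nat option) \<Rightarrow> nat \<Rightarrow> player \<Rightarrow> nat" where
  "game_value G starter c i p =
    (if infinite (verts G) \<or> uncolored G c = {} then i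
     else if moves G c i = {} then game_value G starter c (Suc i) (starter p)
     else if p = Alice
       then Min ((\<lambda>v. game_value G starter (c(v \<mapsto> i)) i (opponent p)) ` moves G c i)
       else Max ((\<lambda>v. game_value G starter (c(v \<mapsto> i)) i (opponent p)) ` moves G c i))"
  by pat_completeness auto

termination
proof (relation "measures
    [\<lambda>(G, _, c, _, _). card (uncolored G c),
     \<lambda>(G, _, c, i, _). Suc (Max (the ` c ` {v \<in> verts G. c v \<noteq> None})) - i]", goal_cases)
  case 1
  show ?case by simp
next
  case (2 G starter c i p)
  then have fin: "finite (verts G)" and "uncolored G c \<noteq> {}" and "moves G c i = {}"
    by auto
  then obtain w where w: "w \<in> verts G" "c w = Some i"
    unfolding moves_def by blast
  then have "i \<in> the ` c ` {v \<in> verts G. c v \<noteq> None}"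
    by force
  with fin have "i \<le> Max (the ` c ` {v \<in> verts G. c v \<noteq> None})"
    by simp
  then show ?case by simp
next
  case (3 G starter c i p v)
  then have "uncolored G (c(v \<mapsto> i)) \<subset> uncolored G c" "finite (uncolored G c)"
    by (auto simp: moves_def uncolored_def split: if_splits)
  then show ?case by (simp add: psubset_card_mono)
next
  case (4 G starter c i p v)
  then have "uncolored G (c(v \<mapsto> i)) \<subset> uncolored G c" "finite (uncolored G c)"
    by (auto simp: moves_def uncolored_def split: if_splits)
  then show ?case by (simp add: psubset_card_mono)
qed

text \<open>The recursion equation loops as a rewrite rule.\<close>

declare game_value.simps [simp del]

text \<open>On the null graph no round is played, so the number of rounds is 0.\<close>

definition game_chromatic :: "(player \<Rightarrow> player) \<Rightarrow> ('a, 'b) pre_digraph \<Rightarrow> nat" where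
  "game_chromatic starter G =
    (if verts G = {} then 0 else game_value G starter (\<lambda>_. None) 1 Alice)"

definition chi_ig_A :: "('a, 'b) pre_digraph \<Rightarrow> nat" where
  "chi_ig_A = game_chromatic (\<lambda>_. Alice)"

definition chi_ig_AB :: "('a, 'b) pre_digraph \<Rightarrow> nat" where
  "chi_ig_AB = game_chromatic (\<lambda>p. p)"

definition lower_game_vertex_critical ::
  "(('a, 'b) pre_digraph \<Rightarrow> nat) \<Rightarrow> ('a, 'b) pre_digraph \<Rightarrow> bool" where
  "lower_game_vertex_critical \<phi> G \<longleftrightarrow>
    (\<forall>x \<in> verts G. \<phi> (pre_digraph.del_vert G x) < \<phi> G)"

end

theory Submission
  imports Defs
begin

text \<open>
  Take the crown graph on \<open>2m\<close> vertices with \<open>m = n + 2\<close>, that is \<open>K\<^bsub>m,m\<^esub>\<close> minus a perfect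
  matching.  Bob answers each move of Alice with the matching partner, which completes the round;
  so every round removes one matching edge and is started by Alice under both rules, and
  \<open>m\<close> rounds are played.  If Bob ever stays on Alice's side, the game ends one round later.
  After deletion of a vertex \<open>x\<close>, Alice starts with the partner of \<open>x\<close>: this forces the first
  round to consist of one full side of the bipartition, and two rounds are enough.
\<close>

section \<open>Positions after a move and the recursion for the game value\<close>

lemma uncolored_upd: "uncolored G (c(v \<mapsto> i)) = uncolored G c - {v}"
  by (auto simp: uncolored_def)

lemma card_uncolored_upd:
  assumes "finite (verts G)" "v \<in> moves G c i"
  shows "card (uncolored G (c(v \<mapsto> i))) < card (uncolored G c)"
  unfolding uncolored_upd using assms
  by (intro card_Diff1_less) (auto simp: uncolored_def moves_def)

lemma moves_upd:
  assumes "v \<in> verts G"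
  shows "moves G (c(v \<mapsto> i)) i = {u \<in> moves G c i. u \<noteq> v \<and> \<not> u \<rightarrow>\<^bsub>G\<^esub> v}"
  using assms by (auto simp: moves_def uncolored_def)

lemma moves_subset: "moves G c i \<subseteq> uncolored G c"
  by (auto simp: moves_def)

lemma finite_moves: "finite (verts G) \<Longrightarrow> finite (moves G c i)"
  by (auto simp: moves_def uncolored_def)

lemma moves_fresh_color:
  assumes "\<And>w. w \<in> verts G \<Longrightarrow> c w \<noteq> Some i"
  shows "moves G c i = uncolored G c"
  using assms by (auto simp: moves_def)

lemma game_value_over:
  "uncolored G c = {} \<Longrightarrow> game_value G s c i p = i"
  by (subst game_value.simps) simp

lemma game_value_next_round:
  assumes "finite (verts G)" "uncolored G c \<noteq> {}" "moves G c i = {}"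
  shows "game_value G s c i p = game_value G s c (Suc i) (s p)"
  using assms by (subst game_value.simps) simp

lemma game_value_move:
  assumes "finite (verts G)" "moves G c i \<noteq> {}"
  shows "game_value G s c i Alice = (MIN v\<in>moves G c i. game_value G s (c(v \<mapsto> i)) i Bob)"
    and "game_value G s c i Bob = (MAX v\<in>moves G c i. game_value G s (c(v \<mapsto> i)) i Alice)"
proof -
  have "uncolored G c \<noteq> {}"
    using assms moves_subset[of G c i] by auto
  then show "game_value G s c i Alice = (MIN v\<in>moves G c i. game_value G s (c(v \<mapsto> i)) i Bob)"
    and "game_value G s c i Bob = (MAX v\<in>moves G c i. game_value G s (c(v \<mapsto> i)) i Alice)"
    using assms by (subst game_value.simps; simp)+
qed

text \<open>Min and Max over a finite nonempty set are attained. Bounds that hold under any play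
  thus need no distinction between Alice and Bob.\<close>

lemma game_value_some_move:
  assumes "finite (verts G)" "moves G c i \<noteq> {}"
  obtains v where "v \<in> moves G c i"
    "game_value G s c i p = game_value G s (c(v \<mapsto> i)) i (opponent p)"
proof -
  let ?V = "(\<lambda>v. game_value G s (c(v \<mapsto> i)) i (opponent p)) ` moves G c i"
  have "finite ?V" "?V \<noteq> {}"
    using assms finite_moves by auto
  moreover have "game_value G s c i p = (case p of Alice \<Rightarrow> Min ?V | Bob \<Rightarrow> Max ?V)"
    using game_value_move[OF assms] by (cases p) auto
  ultimately have "game_value G s c i p \<in> ?V"
    using Min_in Max_in by (cases p) auto
  with that show thesis by auto
qed

section \<open>Bounds on the number of rounds that hold under any play\<close>

lemma game_value_independent:
  assumes "finite (verts G)" "uncolored G c = moves G c i"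
    and "\<And>u v. u \<in> uncolored G c \<Longrightarrow> v \<in> uncolored G c \<Longrightarrow> \<not> u \<rightarrow>\<^bsub>G\<^esub> v"
  shows "game_value G s c i p = i"
  using assms
proof (induction "card (uncolored G c)" arbitrary: c p rule: less_induct)
  case less
  show ?case
  proof (cases "uncolored G c = {}")
    case True
    then show ?thesis by (rule game_value_over)
  next
    case False
    then obtain v where v: "v \<in> moves G c i"
      and eq: "game_value G s c i p = game_value G s (c(v \<mapsto> i)) i (opponent p)"
      using less.prems by (metis game_value_some_move)
    have vG: "v \<in> verts G" and vU: "v \<in> uncolored G c"
      using v by (auto simp: moves_def uncolored_def)
    have "uncolored G (c(v \<mapsto> i)) = moves G (c(v \<mapsto> i)) i"
      unfolding uncolored_upd moves_upd[OF vG] using less.prems(2,3) vU by auto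
    moreover have "\<not> u \<rightarrow>\<^bsub>G\<^esub> w"
      if "u \<in> uncolored G (c(v \<mapsto> i))" "w \<in> uncolored G (c(v \<mapsto> i))" for u w
      using that less.prems(3) by (simp add: uncolored_upd)
    ultimately show ?thesis
      unfolding eq by (intro less.hyps card_uncolored_upd[OF less.prems(1) v] less.prems(1))
  qed
qed

text \<open>The available vertices do not block one another, so round \<open>i\<close> colors
  exactly these, whoever moves and in whatever order. The blocked vertices remain unchanged; they
  are independent and color \<open>Suc i\<close> is still fresh, so the next round takes them
  all.\<close>

lemma game_value_two_independent:
  assumes "finite (verts G)" "\<And>w. w \<in> verts G \<Longrightarrow> c w \<noteq> Some (Suc i)"
    and "\<And>u v. u \<in> moves G c i \<Longrightarrow> v \<in> moves G c i \<Longrightarrow> \<not> u \<rightarrow>\<^bsub>G\<^esub> v"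
    and "\<And>u v. u \<in> uncolored G c - moves G c i \<Longrightarrow> v \<in> uncolored G c - moves G c i \<Longrightarrow> \<not> u \<rightarrow>\<^bsub>G\<^esub> v"
  shows "game_value G s c i p \<le> Suc i"
  using assms
proof (induction "card (uncolored G c)" arbitrary: c p rule: less_induct)
  case less
  consider "uncolored G c = {}" | "uncolored G c \<noteq> {}" "moves G c i = {}" | "moves G c i \<noteq> {}"
    by blast
  then show ?case
  proof cases
    case 1
    then show ?thesis by (simp add: game_value_over)
  next
    case 2
    then have "game_value G s c i p = game_value G s c (Suc i) (s p)"
      by (intro game_value_next_round less.prems(1))
    also have "\<dots> = Suc i"
      using less.prems 2 moves_fresh_color[of G c "Suc i"]
      by (intro game_value_independent) simp_all
    finally show ?thesis by simp
  next
    case 3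
    then obtain v where v: "v \<in> moves G c i"
      and eq: "game_value G s c i p = game_value G s (c(v \<mapsto> i)) i (opponent p)"
      using less.prems(1) by (metis game_value_some_move)
    have vG: "v \<in> verts G"
      using v by (auto simp: moves_def uncolored_def)
    note less_card = card_uncolored_upd[OF less.prems(1) v]
    have M: "moves G (c(v \<mapsto> i)) i = moves G c i - {v}"
      unfolding moves_upd[OF vG] using less.prems(3) v by auto
    have "uncolored G (c(v \<mapsto> i)) - moves G (c(v \<mapsto> i)) i = uncolored G c - moves G c i"
      unfolding M uncolored_upd using v by auto
    with less_card M show ?thesis
      unfolding eq by (intro less.hyps) (use less.prems in auto)
  qed
qed

lemma game_value_ge: "finite (verts G) \<Longrightarrow> i \<le> game_value G s c i p"
proof (induction G s c i p rule: game_value.induct)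
  case (1 G s c i p)
  consider "uncolored G c = {}" | "uncolored G c \<noteq> {}" "moves G c i = {}" | "moves G c i \<noteq> {}"
    by blast
  then show ?case
  proof cases
    case 1
    then show ?thesis by (simp add: game_value_over)
  next
    case 2
    then show ?thesis
      using "1.IH"(1) "1.prems" by (simp add: game_value_next_round)
  next
    case 3
    then obtain v where v: "v \<in> moves G c i"
      and eq: "game_value G s c i p = game_value G s (c(v \<mapsto> i)) i (opponent p)"
      using "1.prems" by (metis game_value_some_move)
    moreover have "uncolored G c \<noteq> {}"
      using v moves_subset by fastforce
    ultimately show ?thesis
      using "1.IH"(2,3)[of v] "1.prems" 3 by (cases "p = Alice") (auto simp del: fun_upd_apply simp: fun_upd_def)
  qed
qed

text \<open>The disjunction is an invariant of round \<open>i\<close>. A blocked vertex stays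
  blocked; an uncolored edge stays uncolored until one endpoint is played, which blocks the other.
  As \<open>G\<close> is not assumed symmetric, both directions of the edge are required, and when
  \<open>v\<close> itself is played the blocked vertex is \<open>u\<close>.\<close>

lemma game_value_ge_Suc:
  assumes "finite (verts G)" "v \<in> uncolored G c"
    and "v \<notin> moves G c i \<or> (\<exists>u \<in> uncolored G c. u \<noteq> v \<and> u \<rightarrow>\<^bsub>G\<^esub> v \<and> v \<rightarrow>\<^bsub>G\<^esub> u)"
  shows "Suc i \<le> game_value G s c i p"
  using assms
proof (induction "card (uncolored G c)" arbitrary: c v p rule: less_induct)
  case less
  show ?case
  proof (cases "moves G c i = {}")
    case True
    then show ?thesis
      using less.prems game_value_ge[of G "Suc i"] by (subst game_value_next_round) auto
  next
    case False
    then obtain w where w: "w \<in> moves G c i"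
      and eq: "game_value G s c i p = game_value G s (c(w \<mapsto> i)) i (opponent p)"
      using less.prems(1) by (metis game_value_some_move)
    have wG: "w \<in> verts G"
      using w by (auto simp: moves_def uncolored_def)
    note less_card = card_uncolored_upd[OF less.prems(1) w]
    note IH = less.hyps[OF less_card less.prems(1)]
    consider "v \<notin> moves G c i" | u where "u \<in> uncolored G c" "u \<noteq> v" "u \<rightarrow>\<^bsub>G\<^esub> v" "v \<rightarrow>\<^bsub>G\<^esub> u"
      using less.prems(3) by blast
    then show ?thesis
    proof cases
      case 1
      then show ?thesis
        unfolding eq using w wG less.prems(2)
        by (intro IH[of v]) (auto simp: uncolored_upd moves_upd)
    next
      case 2
      then show ?thesis
        unfolding eq using w wG less.prems(2) IH[of u] IH[of v]
        by (cases "w = v") (auto simp: uncolored_upd moves_upd)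
    qed
  qed
qed

section \<open>The crown graph and its removed matching\<close>

definition crown :: "nat \<Rightarrow> (nat, nat \<times> nat) pre_digraph" where
  "crown m = \<lparr>verts = {..<2 * m},
     arcs = {(u, v). u < 2 * m \<and> v < 2 * m \<and> u mod 2 \<noteq> v mod 2 \<and> u div 2 \<noteq> v div 2},
     tail = fst, head = snd\<rparr>"

lemma verts_crown: "verts (crown m) = {..<2 * m}"
  by (simp add: crown_def)

lemma adj_crown:
  "u \<rightarrow>\<^bsub>crown m\<^esub> v \<longleftrightarrow> u < 2 * m \<and> v < 2 * m \<and> u mod 2 \<noteq> v mod 2 \<and> u div 2 \<noteq> v div 2"
  by (auto simp: crown_def arcs_ends_def arc_to_ends_def image_iff)

lemma verts_del_crown: "verts (pre_digraph.del_vert (crown m) x) = {..<2 * m} - {x}"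
  by (simp add: pre_digraph.del_vert_def crown_def)

lemma adj_del_crown:
  "u \<rightarrow>\<^bsub>pre_digraph.del_vert (crown m) x\<^esub> v \<longleftrightarrow> u \<rightarrow>\<^bsub>crown m\<^esub> v \<and> u \<noteq> x \<and> v \<noteq> x"
  by (auto simp: pre_digraph.del_vert_def crown_def arcs_ends_def arc_to_ends_def image_iff)

lemma graph_crown: "graph (crown m)"
proof
  have "arcs (crown m) \<subseteq> {..<2 * m} \<times> {..<2 * m}"
    by (auto simp: crown_def)
  then show "finite (arcs (crown m))"
    by (rule finite_subset) simp
qed (auto simp: crown_def arc_to_ends_def symmetric_def arcs_ends_def image_iff intro!: symI)

definition partner :: "nat \<Rightarrow> nat" where
  "partner v = (if even v then v + 1 else v - 1)"

lemma partner:
  "partner v div 2 = v div 2" "partner v mod 2 \<noteq> v mod 2" "partner v < 2 * m \<longleftrightarrow> v < 2 * m"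
  by (auto simp: partner_def elim!: evenE oddE)

lemma partner_unique: "w div 2 = v div 2 \<Longrightarrow> w \<noteq> v \<Longrightarrow> w = partner v"
  unfolding partner_def by presburger

text \<open>Two vertices off the side of \<open>v\<close> share a side and hence are not adjacent;
  this supplies the independence of the blocked vertices below.\<close>

lemma mod2_cases: "(u::nat) mod 2 \<noteq> v mod 2 \<Longrightarrow> w mod 2 \<noteq> v mod 2 \<Longrightarrow> u mod 2 = w mod 2"
  by presburger

section \<open>The game on the crown graph\<close>

text \<open>\<open>K\<close> indexes the matching edges that are still uncolored. Any other
  uncolored vertex is adjacent to \<open>partner v\<close> if it lies on the side of
  \<open>v\<close>, and to \<open>v\<close> otherwise, so the round is complete. Alice is then next
  to move, and \<open>s Alice = Alice\<close>, true under both rules, lets her start the next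
  round.\<close>

lemma game_value_crown_Bob_partner:
  assumes U: "uncolored (crown m) c = {v. v < 2 * m \<and> v div 2 \<in> K}"
    and v: "v < 2 * m" "v div 2 \<in> K" and "\<And>w. c w \<noteq> Some i"
    and "s Alice = Alice"
  defines "c' \<equiv> c(v \<mapsto> i, partner v \<mapsto> i)"
  shows "uncolored (crown m) c' = {u. u < 2 * m \<and> u div 2 \<in> K - {v div 2}}"
    and "uncolored (crown m) c' \<noteq> {} \<Longrightarrow>
      game_value (crown m) s c' i Alice = game_value (crown m) s c' (Suc i) Alice"
proof -
  show U': "uncolored (crown m) c' = {u. u < 2 * m \<and> u div 2 \<in> K - {v div 2}}"
    using U partner_unique partner(1)[of v] unfolding c'_def uncolored_upd by auto
  have "moves (crown m) c' i = {}"
  proof -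
    have "\<exists>w \<in> verts (crown m). c' w = Some i \<and> u \<rightarrow>\<^bsub>crown m\<^esub> w"
      if "u \<in> uncolored (crown m) c'" for u
    proof (cases "u mod 2 = v mod 2")
      case True
      then show ?thesis
        using that v partner[of v] unfolding U'
        by (intro bexI[of _ "partner v"]) (auto simp: c'_def adj_crown verts_crown)
    next
      case False
      then show ?thesis
        using that v unfolding U'
        by (intro bexI[of _ v]) (auto simp: c'_def adj_crown verts_crown)
    qed
    then show ?thesis by (auto simp: moves_def)
  qed
  then show "uncolored (crown m) c' \<noteq> {} \<Longrightarrow>
      game_value (crown m) s c' i Alice = game_value (crown m) s c' (Suc i) Alice"
    using assms(5) by (subst game_value_next_round) (auto simp: verts_crown)
qed

text \<open>Induction on the number \<open>Suc k\<close> of uncolored matching edges, at the start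
  of a round. The rounds still to be played are \<open>i\<close>, ..., \<open>i + k\<close>, one per
  edge, whatever Alice does.\<close>

lemma game_value_crown:
  assumes "uncolored (crown m) c = {v. v < 2 * m \<and> v div 2 \<in> K}"
    and "K \<subseteq> {..<m}" "card K = Suc k" "\<And>v j. i \<le> j \<Longrightarrow> c v \<noteq> Some j"
    and "s Alice = Alice"
  shows "game_value (crown m) s c i Alice = i + k"
  using assms
proof (induction k arbitrary: c K i rule: less_induct)
  case (less k c K i)
  let ?G = "crown m"
  note U = less.prems(1)
  have fin: "finite (verts ?G)" by (simp add: verts_crown)
  have M: "moves ?G c i = uncolored ?G c"
    using less.prems(4) by (intro moves_fresh_color) auto
  have finK: "finite K"
    using less.prems(2) finite_subset by blast
  \<comment> \<open>Every opening move of Alice has the same value, so her minimum is over a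
    constant. Bob attains \<open>i + k\<close> with the partner, and no other reply exceeds
    it.\<close>
  have Bob: "game_value ?G s (c(v \<mapsto> i)) i Bob = i + k" if v: "v \<in> moves ?G c i" for v
  proof -
    have vK: "v < 2 * m" "v div 2 \<in> K"
      using v unfolding M U by auto
    have vG: "v \<in> verts ?G"
      using vK by (simp add: verts_crown)
    have M1: "moves ?G (c(v \<mapsto> i)) i = {u \<in> uncolored ?G c. u \<noteq> v \<and> \<not> u \<rightarrow>\<^bsub>?G\<^esub> v}"
      unfolding moves_upd[OF vG] M ..
    have pM: "partner v \<in> moves ?G (c(v \<mapsto> i)) i"
      unfolding M1 U using vK partner[of v] by (auto simp: adj_crown)
    have card': "card (K - {v div 2}) = k"
      using less.prems(3) vK finK by simp
    note U2 = game_value_crown_Bob_partner(1)[OF U vK, of i s]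
    note next2 = game_value_crown_Bob_partner(2)[OF U vK, of i s]
    have partner_value: "game_value ?G s (c(v \<mapsto> i, partner v \<mapsto> i)) i Alice = i + k"
    proof (cases k)
      case 0
      then have "K - {v div 2} = {}"
        using card' finK by auto
      then show ?thesis
        using U2 less.prems(4,5) 0 by (subst game_value_over) auto
    next
      case (Suc k')
      then obtain a where a: "a \<in> K - {v div 2}"
        using card' by (metis card.empty ex_in_conv nat.distinct(1))
      \<comment> \<open>\<open>2 * a\<close> is the even endpoint of matching edge \<open>a\<close>;
        it shows that the game is not over.\<close>
      then have "2 * a \<in> uncolored ?G (c(v \<mapsto> i, partner v \<mapsto> i))"
        using U2 less.prems(2,4,5) by auto
      then have "game_value ?G s (c(v \<mapsto> i, partner v \<mapsto> i)) i Alice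
          = game_value ?G s (c(v \<mapsto> i, partner v \<mapsto> i)) (Suc i) Alice"
        using next2 less.prems(4,5) by blast
      also have "\<dots> = Suc i + k'"
      proof (rule less.IH)
        show "uncolored ?G (c(v \<mapsto> i, partner v \<mapsto> i)) = {u. u < 2 * m \<and> u div 2 \<in> K - {v div 2}}"
          using U2 less.prems(4,5) by blast
      qed (use less.prems Suc card' in auto)
      finally show ?thesis
        using Suc by simp
    qed
    \<comment> \<open>Such a \<open>w\<close> lies on the side of \<open>v\<close> but on another
      matching edge, whence \<open>k \<ge> 1\<close>. Now \<open>w\<close> blocks
      \<open>partner v\<close>, and \<open>v\<close> blocks the rest of the opposite side, so one
      further round suffices.\<close>
    have stay_value: "game_value ?G s (c(v \<mapsto> i, w \<mapsto> i)) i Alice \<le> i + k"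
      if w: "w \<in> moves ?G (c(v \<mapsto> i)) i" "w \<noteq> partner v" for w
    proof -
      have wK: "w < 2 * m" "w div 2 \<in> K" "w \<noteq> v" "\<not> w \<rightarrow>\<^bsub>?G\<^esub> v"
        using w(1) unfolding M1 U by auto
      have div: "w div 2 \<noteq> v div 2"
        using partner_unique wK(3) w(2) by blast
      then have mod: "w mod 2 = v mod 2"
        using wK vK by (auto simp: adj_crown)
      have "w div 2 \<in> K - {v div 2}"
        using wK div by simp
      then have "k \<ge> 1"
        using card' finK by (metis One_nat_def Suc_leI card_gt_0_iff empty_iff finite_Diff)
      have wG: "w \<in> verts ?G"
        using wK by (simp add: verts_crown)
      have U2: "uncolored ?G (c(v \<mapsto> i, w \<mapsto> i)) = uncolored ?G c - {v, w}"
        by (auto simp: uncolored_upd)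
      have M2: "moves ?G (c(v \<mapsto> i, w \<mapsto> i)) i = {u \<in> uncolored ?G c - {v, w}. u mod 2 = v mod 2}"
        unfolding moves_upd[OF wG] M1 U using wK vK div mod by (auto simp: adj_crown)
      have "game_value ?G s (c(v \<mapsto> i, w \<mapsto> i)) i Alice \<le> Suc i"
        by (rule game_value_two_independent[OF fin])
          (use less.prems(4) in \<open>auto simp: U2 M2 adj_crown dest: mod2_cases\<close>)
      with \<open>k \<ge> 1\<close> show ?thesis by simp
    qed
    have "(MAX w\<in>moves ?G (c(v \<mapsto> i)) i. game_value ?G s (c(v \<mapsto> i, w \<mapsto> i)) i Alice) = i + k"
    proof (rule Max_eqI)
      show "finite ((\<lambda>w. game_value ?G s (c(v \<mapsto> i, w \<mapsto> i)) i Alice) ` moves ?G (c(v \<mapsto> i)) i)"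
        by (intro finite_imageI finite_moves fin)
      show "y \<le> i + k"
        if y: "y \<in> (\<lambda>w. game_value ?G s (c(v \<mapsto> i, w \<mapsto> i)) i Alice) ` moves ?G (c(v \<mapsto> i)) i" for y
      proof -
        obtain w where "w \<in> moves ?G (c(v \<mapsto> i)) i"
          and "y = game_value ?G s (c(v \<mapsto> i, w \<mapsto> i)) i Alice"
          using y by blast
        then show ?thesis
          using stay_value[of w] partner_value by (cases "w = partner v") simp_all
      qed
      show "i + k \<in> (\<lambda>w. game_value ?G s (c(v \<mapsto> i, w \<mapsto> i)) i Alice) ` moves ?G (c(v \<mapsto> i)) i"
        by (rule rev_image_eqI[OF pM]) (simp only: partner_value)
    qed
    then show ?thesis
      using game_value_move(2)[OF fin, of "c(v \<mapsto> i)" i s] pM by fastforce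
  qed
  obtain a where "a \<in> K"
    using less.prems(3) by fastforce
  then have ne: "moves ?G c i \<noteq> {}"
    using less.prems(2) unfolding M U by (auto intro!: exI[of _ "2 * a"])
  have "game_value ?G s c i Alice = (MIN v\<in>moves ?G c i. game_value ?G s (c(v \<mapsto> i)) i Bob)"
    by (rule game_value_move(1)[OF fin ne])
  also have "\<dots> = (MIN v\<in>moves ?G c i. i + k)"
    using Bob by simp
  also have "\<dots> = i + k"
    using ne by (simp add: image_constant_conv)
  finally show ?case .
qed

section \<open>Number of rounds before and after deleting a vertex\<close>

lemma game_chromatic_crown:
  assumes "m > 0" "s Alice = Alice"
  shows "game_chromatic s (crown m) = m"
proof -
  have "game_value (crown m) s (\<lambda>_. None) 1 Alice = 1 + (m - 1)"
    by (rule game_value_crown[where K = "{..<m}"])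
      (use assms in \<open>auto simp: uncolored_def verts_crown\<close>)
  then show ?thesis
    using assms(1) by (simp add: game_chromatic_def verts_crown lessThan_empty_iff bot_nat_def)
qed

lemma game_chromatic_del_crown:
  assumes "m \<ge> 3" "x \<in> verts (crown m)"
  shows "game_chromatic s (pre_digraph.del_vert (crown m) x) = 2"
proof -
  let ?H = "pre_digraph.del_vert (crown m) x" and ?c = "\<lambda>_. None :: nat option"
  have x: "x < 2 * m"
    using assms by (simp add: verts_crown)
  have fin: "finite (verts ?H)"
    by (simp add: verts_del_crown)
  have U: "uncolored ?H ?c = {..<2 * m} - {x}"
    by (auto simp: uncolored_def verts_del_crown)
  have M: "moves ?H ?c 1 = {..<2 * m} - {x}"
    unfolding U[symmetric] by (intro moves_fresh_color) auto
  \<comment> \<open>Alice's opening move: its only non-neighbor on the opposite side was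
    \<open>x\<close>, so \<open>y\<close> blocks that whole side and Bob can no longer complete the
    round with a partner.\<close>
  define y where "y = partner x"
  have y: "y < 2 * m" "y \<noteq> x" "y div 2 = x div 2" "y mod 2 \<noteq> x mod 2"
    using x partner[of x] unfolding y_def by auto
  have yH: "y \<in> verts ?H" and yM: "y \<in> moves ?H ?c 1"
    using y unfolding M by (auto simp: verts_del_crown)
  have M1: "moves ?H (?c(y \<mapsto> 1)) 1 = {u \<in> {..<2 * m} - {x, y}. u mod 2 = y mod 2}"
  proof -
    have "u div 2 \<noteq> y div 2" if "u \<noteq> x" "u \<noteq> y" for u
      using that partner_unique[of u x] y(3) unfolding y_def by metis
    then show ?thesis
      unfolding moves_upd[OF yH] M using y by (auto simp: adj_del_crown adj_crown)
  qed
  have U1: "uncolored ?H (?c(y \<mapsto> 1)) = {..<2 * m} - {x, y}"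
    unfolding uncolored_upd U by auto
  have "game_value ?H s ?c 1 Alice \<le> game_value ?H s (?c(y \<mapsto> 1)) 1 Bob"
    using yM fin finite_moves[OF fin] by (subst game_value_move(1)) (auto intro!: Min_le)
  also have "\<dots> \<le> Suc 1"
    by (rule game_value_two_independent[OF fin])
      (auto simp: U1 M1 adj_del_crown adj_crown simp del: One_nat_def dest: mod2_cases)
  finally have "game_value ?H s ?c 1 Alice \<le> 2"
    by simp
  moreover have "Suc 1 \<le> game_value ?H s ?c 1 Alice"
  proof -
    \<comment> \<open>Of the first three matching edges, which exist as \<open>m \<ge> 3\<close>,
      two avoid \<open>x\<close>. The even endpoint of one and the odd endpoint of the other are
      adjacent, so one round cannot be enough.\<close>
    obtain a b where ab: "a < 3" "b < 3" "a \<noteq> b" "a \<noteq> x div 2" "b \<noteq> x div 2"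
    proof -
      consider "x div 2 = 0" | "x div 2 = 1" | "x div 2 \<ge> 2"
        by linarith
      then show thesis
        by cases (use that[of 1 2] that[of 0 2] that[of 0 1] in auto)
    qed
    show ?thesis
      by (rule game_value_ge_Suc[OF fin, of "2 * a"])
        (use ab assms(1) in \<open>auto simp: U adj_del_crown adj_crown intro!: bexI[of _ "2 * b + 1"]\<close>)
  qed
  moreover have "verts ?H \<noteq> {}"
    using yH by auto
  ultimately show ?thesis
    by (simp add: game_chromatic_def)
qed

theorem proposition18:
  fixes n :: nat
  assumes "n \<ge> 1"
  shows "\<exists>G :: (nat, nat \<times> nat) pre_digraph.
    graph G \<and> verts G \<noteq> {} \<and>
    lower_game_vertex_critical chi_ig_A G \<and>
    lower_game_vertex_critical chi_ig_AB G \<and>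
    (\<forall>x \<in> verts G.
      int (chi_ig_A G) - int (chi_ig_A (pre_digraph.del_vert G x)) = int n \<and>
      int (chi_ig_AB G) - int (chi_ig_AB (pre_digraph.del_vert G x)) = int n)"
proof (intro exI[of _ "crown (n + 2)"] conjI graph_crown)
  show "verts (crown (n + 2)) \<noteq> {}"
    by (auto simp: verts_crown)
\<comment> \<open>The crown needs \<open>n + 2\<close> rounds and each vertex-deleted subgraph
  \<open>2\<close>; \<open>n \<ge> 1\<close> makes \<open>m = n + 2\<close> at least
  \<open>3\<close>.\<close>
qed (use assms in \<open>auto simp: lower_game_vertex_critical_def chi_ig_A_def chi_ig_AB_def
    game_chromatic_crown game_chromatic_del_crown\<close>)

end
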